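(* Let $k \geq 2$ be a positive integer and let $f\colon [1,\infty) \to \mathbb{R}$ be a $k$-times continuously differentiable function such that $$\lim_{x \to \infty} f^{(k)}(x) = 0 \qquad\text{and}\qquad \limsup_{x \to \infty} f^{(k-1)}(x) = \infty.$$ Then for any positive integer $H \geq k$, there exist infinitely many positive integers $n$ such that for all integers $h_1 < h_2 < \cdots < h_k$ in $[1,H]$, $$\gcd\left(\lfloor f(n+h_1)\rfloor, \lfloor f(n+h_2)\rfloor, \ldots, \lfloor f(n+h_k)\rfloor\right) = 1.$$
   Context: $\lfloor x \rfloor$ denotes the greatest integer less than or equal to the real number $x$. $f^{(i)}$ denotes the $i$-th derivative of $f$, with $f^{(0)} = f$. *)

theory Defs
  imports "HOL-Analysis.Analysis"
begin

text \<open>Derivatives are taken within S, hence one-sided at a boundary point of S. In particular,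
  at points of S they depend only on the restriction of f to S.\<close>

definition nth_deriv_within :: "real set \<Rightarrow> nat \<Rightarrow> (real \<Rightarrow> real) \<Rightarrow> real \<Rightarrow> real" where
  "nth_deriv_within S i f = ((\<lambda>g x. vector_derivative g (at x within S)) ^^ i) f"

definition times_cont_differentiable_on :: "nat \<Rightarrow> (real \<Rightarrow> real) \<Rightarrow> real set \<Rightarrow> bool" where
  "times_cont_differentiable_on k f S \<longleftrightarrow>
     (\<forall>i<k. nth_deriv_within S i f differentiable_on S) \<and>
     continuous_on S (nth_deriv_within S k f)"

end

theory Submission
  imports Defs "HOL-Computational_Algebra.Polynomial" "HOL-Computational_Algebra.Primes"
begin

text \<open>Let M = H! and write D_j for the j-th forward difference of f at integers. By the mean value
  theorem D_k tends to 0 and D_(k-1) is unbounded above, so D_(k-1) crosses powers b of M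
  arbitrarily slowly. Around such a crossing the remaining differences drift through the torus, and
  one finds n with D_1, ..., D_(k-2) close to multiples of M and D_0 close to 3/2 modulo M. Newton's
  formula then gives floor (f (n + h)) = sum of A_j (h choose j) over j < k, for all h up to H, where
  A_0 is 1 modulo M, the other A_j are multiples of M, and A_(k-1) = b. A prime p dividing k of
  these values does not divide M, so p > H; hence this polynomial in h, scaled by
  (k-1)! to have integer coefficients, has k distinct roots modulo p, so p divides its leading
  coefficient b, a power of M: a contradiction.\<close>

section \<open>Forward differences and Newton expansions\<close>

primrec fdiff :: "nat \<Rightarrow> (nat \<Rightarrow> 'a::ab_group_add) \<Rightarrow> nat \<Rightarrow> 'a" where
  "fdiff 0 u = u"
| "fdiff (Suc j) u = (\<lambda>t. fdiff j u (Suc t) - fdiff j u t)"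

lemma fdiff_shift: "fdiff j (\<lambda>s. u (t + s)) s = fdiff j u (t + s)"
  by (induction j arbitrary: s) auto

text \<open>Trades the outermost difference for an innermost one, the form that the induction in
  \<open>fdiff_eq_derivative\<close> needs.\<close>

lemma fdiff_Suc_inner: "fdiff (Suc j) u t = fdiff j (\<lambda>s. u (Suc s) - u s) t"
proof (induction j arbitrary: t)
  case (Suc j)
  have "fdiff (Suc (Suc j)) u t = fdiff (Suc j) u (Suc t) - fdiff (Suc j) u t"
    by simp
  also have "\<dots> = fdiff (Suc j) (\<lambda>s. u (Suc s) - u s) t"
    unfolding Suc.IH by simp
  finally show ?case .
qed simp

lemma fdiff_diff: "fdiff j (\<lambda>s. u s - v s) t = fdiff j u t - fdiff j v t"
  by (induction j arbitrary: t) auto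

lemma fdiff_divide:
  fixes u :: "nat \<Rightarrow> 'a::field"
  shows "fdiff j (\<lambda>s. u s / c) t = fdiff j u t / c"
  by (induction j arbitrary: t) (auto simp: diff_divide_distrib)

lemma fdiff_const: "fdiff j (\<lambda>s. c) t = (if j = 0 then c else 0)"
  by (induction j arbitrary: t) auto

text \<open>By Pascal's rule one difference turns \<open>h choose Suc j\<close> into
  \<open>h choose j\<close>, so it drops the lowest coefficient and shifts the others down. At
  \<open>h = 0\<close> with \<open>i < k\<close> this reads off \<open>A i\<close>; for
  \<open>i = k\<close> the sum is empty.\<close>

lemma fdiff_binomial_sum:
  fixes A :: "nat \<Rightarrow> 'a::comm_ring_1"
  assumes "i \<le> k"
  shows "fdiff i (\<lambda>h. \<Sum>j<k. A j * of_nat (h choose j)) h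
    = (\<Sum>j<k - i. A (j + i) * of_nat (h choose j))"
  using assms
proof (induction i arbitrary: h)
  case (Suc i)
  obtain l where l: "k - i = Suc l" "k - Suc i = l"
    using Suc.prems by (metis Suc_diff_Suc Suc_le_lessD)
  have "fdiff (Suc i) (\<lambda>h. \<Sum>j<k. A j * of_nat (h choose j)) h
      = (\<Sum>j<Suc l. A (j + i) * of_nat (Suc h choose j))
        - (\<Sum>j<Suc l. A (j + i) * of_nat (h choose j))"
    using Suc by (simp add: l del: sum.lessThan_Suc)
  also have "\<dots> = (\<Sum>j<l. A (j + Suc i) * of_nat (h choose j))"
    unfolding sum.lessThan_Suc_shift by (simp add: sum_subtractf[symmetric] algebra_simps)
  finally show ?case by (simp add: l)
qed simp

text \<open>The difference of order \<open>j\<close> at \<open>h + 1\<close> is the sum of those of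
  orders \<open>j\<close> and \<open>j + 1\<close> at \<open>h\<close>, so the bound doubles with
  each step. The recursion stops at order \<open>k\<close>, which is therefore bounded on the whole
  range.\<close>

lemma abs_le_of_fdiff_small:
  fixes e :: "nat \<Rightarrow> real"
  assumes "\<And>j. j < k \<Longrightarrow> \<bar>fdiff j e 0\<bar> \<le> \<epsilon>"
    and "\<And>h. h \<le> H \<Longrightarrow> \<bar>fdiff k e h\<bar> \<le> \<epsilon>"
    and "0 \<le> \<epsilon>" "j \<le> k" "h \<le> H"
  shows "\<bar>fdiff j e h\<bar> \<le> 2 ^ h * \<epsilon>"
  using \<open>j \<le> k\<close> \<open>h \<le> H\<close>
proof (induction h arbitrary: j)
  case 0
  then show ?case using assms(1)[of j] assms(2)[of 0] by (cases "j = k") auto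
next
  case (Suc h)
  show ?case
  proof (cases "j = k")
    case True
    have "\<epsilon> * 1 \<le> \<epsilon> * 2 ^ Suc h"
      by (rule mult_left_mono) (use assms(3) in \<open>auto simp del: power_Suc\<close>)
    then show ?thesis using assms(2)[OF Suc.prems(2)] True by (simp add: mult.commute)
  next
    case False
    have "fdiff j e (Suc h) = fdiff j e h + fdiff (Suc j) e h" by simp
    moreover have "\<bar>fdiff j e h\<bar> \<le> 2 ^ h * \<epsilon>" "\<bar>fdiff (Suc j) e h\<bar> \<le> 2 ^ h * \<epsilon>"
      using Suc.IH[of j] Suc.IH[of "Suc j"] Suc.prems False by auto
    ultimately show ?thesis by (simp only: power_Suc)
  qed
qed

section \<open>Drift modulo one\<close>

text \<open>With the integer parts of its steps removed, the sequence climbs by between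
  \<open>a\<close> and \<open>b\<close> per step and by at least 1 over \<open>N\<close> steps. So
  it reaches an integer translate of \<open>c\<close>, and at the first passage overshoots it by at
  most \<open>b\<close>.\<close>

lemma drift_hits_mod_one:
  fixes y :: "nat \<Rightarrow> real"
  assumes "0 < a" "1 \<le> real N * a"
    and step: "\<And>t. t < N \<Longrightarrow> \<exists>m::int. y (Suc t) - y t - m \<in> {a..b}"
    and "0 < N"
  shows "\<exists>t\<le>N. \<exists>m::int. y t - m \<in> {c..c + b}"
proof -
  obtain m :: "nat \<Rightarrow> int" where m: "\<And>t. t < N \<Longrightarrow> y (Suc t) - y t - m t \<in> {a..b}"
    using step by metis
  define z where "z t = y t - (\<Sum>s<t. m s)" for t
  have z: "z (Suc t) - z t \<in> {a..b}" if "t < N" for t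
    using m[OF that] by (simp add: z_def algebra_simps)
  have lower: "t \<le> N \<Longrightarrow> y 0 + real t * a \<le> z t" for t
  proof (induction t)
    case (Suc t)
    then show ?case using z[of t] by (simp add: algebra_simps)
  qed (simp add: z_def)
  \<comment> \<open>The least integer translate of \<open>c\<close> not below the start is less than
    1 above it, hence within the total climb.\<close>
  define K where "K = \<lceil>y 0 - c\<rceil>"
  have K: "y 0 \<le> c + K" "c + K < y 0 + 1" unfolding K_def by linarith+
  have ex: "c + K \<le> z N" using lower[of N] K assms(2) by simp
  define t where "t = (LEAST t. c + K \<le> z t)"
  have t: "c + K \<le> z t" "t \<le> N"
    unfolding t_def by (rule LeastI[of _ N], rule ex, rule Least_le, rule ex)
  have "z t \<le> c + K + b"
  proof (cases t)
    case 0
    have "a \<le> b" using z[OF \<open>0 < N\<close>] by simp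
    then show ?thesis using K assms(1) 0 by (simp add: z_def)
  next
    case (Suc t')
    then have "\<not> c + K \<le> z t'" using not_less_Least[of t' "\<lambda>t. c + K \<le> z t"] by (simp add: t_def)
    then show ?thesis using z[of t'] t(2) Suc by simp
  qed
  then have "y t - of_int (K + (\<Sum>s<t. m s)) \<in> {c..c + b}"
    using t by (simp add: z_def algebra_simps)
  then show ?thesis using t(2) by blast
qed

text \<open>By induction on d: if the top difference drifts by about \<theta> per step, with \<theta> tiny compared
  with the data for d, then the difference of order d stays near the value required by the
  induction hypothesis for as long as needed.\<close>

lemma fdiff_simultaneously_near_int:
  fixes \<epsilon> :: real
  assumes "0 < \<epsilon>"
  shows "\<exists>\<theta> \<eta> N. 0 < \<theta> \<and> \<theta> < \<epsilon> \<and> 0 < \<eta> \<and> \<eta> < \<epsilon> \<and>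
    (\<forall>u :: nat \<Rightarrow> real. (\<forall>t\<le>N. \<exists>m::int. \<bar>fdiff d u t - m - \<theta>\<bar> \<le> \<eta>) \<longrightarrow>
      (\<exists>t\<le>N. \<forall>j<d. \<exists>m::int. \<bar>fdiff j u t - m\<bar> < \<epsilon>))"
  using assms
proof (induction d arbitrary: \<epsilon>)
  case 0
  show ?case
    by (rule exI[of _ "\<epsilon> / 2"], rule exI[of _ "\<epsilon> / 2"], rule exI[of _ 0]) (use 0 in auto)
next
  case (Suc d)
  \<comment> \<open>Halving leaves room at order \<open>d\<close>, where offset \<theta>' and
    tolerance \<eta>' together must stay below \<epsilon>.\<close>
  have "0 < \<epsilon> / 2" using Suc.prems by simp
  from Suc.IH[OF this] obtain \<theta>' \<eta>' N' where
    IH0: "0 < \<theta>'" "\<theta>' < \<epsilon> / 2" "0 < \<eta>'" "\<eta>' < \<epsilon> / 2" and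
    IH: "\<And>u :: nat \<Rightarrow> real. \<forall>t\<le>N'. \<exists>m::int. \<bar>fdiff d u t - m - \<theta>'\<bar> \<le> \<eta>' \<Longrightarrow>
      \<exists>t\<le>N'. \<forall>j<d. \<exists>m::int. \<bar>fdiff j u t - m\<bar> < \<epsilon> / 2"
    by metis
  \<comment> \<open>The second bound keeps \<open>N' + 1\<close> steps of at most
    \<open>3 * \<theta> / 2\<close> within \<eta>'.\<close>
  define \<theta> where "\<theta> = min (\<epsilon> / 2) (\<eta>' / (2 * (real N' + 1)))"
  have \<theta>0: "0 < \<theta>" "\<theta> < \<epsilon>" using IH0 Suc.prems by (auto simp: \<theta>_def)
  have "\<theta> \<le> \<eta>' / (2 * (real N' + 1))" by (simp add: \<theta>_def)
  then have "\<theta> * (2 * (real N' + 1)) \<le> \<eta>'" by (simp add: pos_le_divide_eq)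
  then have small: "3 * \<theta> / 2 * (real N' + 1) \<le> \<eta>'"
    using IH0(3) by (simp add: algebra_simps)
  \<comment> \<open>This many steps of at least \<open>\<theta> / 2\<close> climb by at least
    1.\<close>
  define N1 where "N1 = nat \<lceil>2 / \<theta>\<rceil>"
  have N1: "2 / \<theta> \<le> real N1" unfolding N1_def by linarith
  then have N1': "1 \<le> real N1 * (\<theta> / 2)" using \<theta>0 by (simp add: field_simps)
  then have "0 < N1" by (cases N1) auto
  show ?case
  \<comment> \<open>Tolerance \<open>\<theta> / 2\<close> puts each step of the order
    \<open>d\<close> difference, modulo 1, between \<open>\<theta> / 2\<close> and
    \<open>3 * \<theta> / 2\<close>. The first \<open>N1\<close> steps serve to reach \<theta>', the
    other \<open>N'\<close> to apply the induction hypothesis from there.\<close>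
  proof (rule exI[of _ \<theta>], rule exI[of _ "\<theta> / 2"], rule exI[of _ "N1 + N'"], intro conjI allI impI)
    fix u :: "nat \<Rightarrow> real"
    assume u: "\<forall>t\<le>N1 + N'. \<exists>m::int. \<bar>fdiff (Suc d) u t - m - \<theta>\<bar> \<le> \<theta> / 2"
    have step: "\<exists>m::int. fdiff d u (Suc t) - fdiff d u t - m \<in> {\<theta> / 2..3 * \<theta> / 2}"
      if t: "t \<le> N1 + N'" for t
    proof -
      obtain m :: int where "\<bar>fdiff (Suc d) u t - m - \<theta>\<bar> \<le> \<theta> / 2" using u t by blast
      then show ?thesis
        unfolding abs_le_iff fdiff.simps atLeastAtMost_iff by (intro exI[of _ m]) linarith
    qed
    have "\<exists>t\<le>N1. \<exists>m::int. fdiff d u t - m \<in> {\<theta>'..\<theta>' + 3 * \<theta> / 2}"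
      by (rule drift_hits_mod_one[of "\<theta> / 2"]) (use N1' \<open>0 < N1\<close> step \<theta>0 in auto)
    then obtain t m where t: "t \<le> N1" and m: "fdiff d u t - of_int m \<in> {\<theta>'..\<theta>' + 3 * \<theta> / 2}"
      by blast
    \<comment> \<open>The 1 in \<open>real s + 1\<close> pays for the overshoot at time
      \<open>t\<close>.\<close>
    have near: "s \<le> N' \<Longrightarrow> \<exists>m::int. \<bar>fdiff d u (t + s) - m - \<theta>'\<bar> \<le> 3 * \<theta> / 2 * (real s + 1)" for s
    proof (induction s)
      case 0
      then show ?case using m \<theta>0 by (intro exI[of _ m]) (auto simp: abs_le_iff)
    next
      case (Suc s)
      obtain m where m: "\<bar>fdiff d u (t + s) - of_int m - \<theta>'\<bar> \<le> 3 * \<theta> / 2 * (real s + 1)"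
        using Suc by auto
      obtain m' where "fdiff d u (Suc (t + s)) - fdiff d u (t + s) - of_int m' \<in> {\<theta> / 2..3 * \<theta> / 2}"
        using step[of "t + s"] t Suc.prems by auto
      then have "\<bar>fdiff d u (Suc (t + s)) - of_int (m + m') - \<theta>'\<bar> \<le> 3 * \<theta> / 2 * (real s + 1) + 3 * \<theta> / 2"
        using m unfolding abs_le_iff atLeastAtMost_iff of_int_add by linarith
      also have "\<dots> = 3 * \<theta> / 2 * (real (Suc s) + 1)" by (simp add: field_simps)
      finally show ?case by (intro exI[of _ "m + m'"]) simp
    qed
    have near': "\<exists>m::int. \<bar>fdiff d u (t + s) - m - \<theta>'\<bar> \<le> \<eta>'" if "s \<le> N'" for s
    proof -
      have "3 * \<theta> / 2 * (real s + 1) \<le> 3 * \<theta> / 2 * (real N' + 1)"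
        using that \<theta>0 by (intro mult_left_mono) auto
      then show ?thesis using near[OF that] small by (meson order_trans)
    qed
    obtain s where s: "s \<le> N'" "\<And>j. j < d \<Longrightarrow> \<exists>m::int. \<bar>fdiff j u (t + s) - m\<bar> < \<epsilon> / 2"
      using IH[of "\<lambda>s. u (t + s)"] near' unfolding fdiff_shift by blast
    have "\<exists>m::int. \<bar>fdiff j u (t + s) - m\<bar> < \<epsilon>" if "j < Suc d" for j
    proof (cases "j = d")
      case True
      obtain m where "\<bar>fdiff d u (t + s) - of_int m - \<theta>'\<bar> \<le> \<eta>'" using near'[OF s(1)] by blast
      then show ?thesis using IH0 True by (intro exI[of _ m]) (auto simp: abs_le_iff abs_less_iff)
    next
      case False
      then obtain m where "\<bar>fdiff j u (t + s) - of_int m\<bar> < \<epsilon> / 2" using s(2)[of j] \<open>j < Suc d\<close> by auto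
      then show ?thesis using Suc.prems by (intro exI[of _ m]) linarith
    qed
    then show "\<exists>t\<le>N1 + N'. \<forall>j<Suc d. \<exists>m::int. \<bar>fdiff j u t - m\<bar> < \<epsilon>"
      using t s(1) by (intro exI[of _ "t + s"]) auto
  qed (use \<theta>0 in auto)
qed

section \<open>Slow crossings of powers of M, and floors as binomial sums\<close>

text \<open>The order of choices matters: the window length \<open>N\<close> depends only on
  \<epsilon> and \<open>d\<close>, so the crossing can be sought so late that the difference of
  order \<open>k - 1\<close> hardly moves during the whole window.\<close>

lemma floor_eq_binomial_sum_infinitely_often:
  fixes u :: "nat \<Rightarrow> real" and M :: int
  assumes "2 \<le> k" "2 \<le> M"
    and lim: "fdiff k u \<longlonglongrightarrow> 0"
    and unb: "\<And>B n0. \<exists>n\<ge>n0. B \<le> fdiff (k - 1) u n"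
  shows "\<exists>n\<ge>n0. \<exists>A :: nat \<Rightarrow> int. (\<forall>h\<le>H. \<lfloor>u (n + h)\<rfloor> = (\<Sum>j<k. A j * int (h choose j)))
    \<and> M dvd A 0 - 1 \<and> (\<forall>j. 0 < j \<and> j < k \<longrightarrow> M dvd A j) \<and> (\<exists>m. A (k - 1) = M ^ m)"
proof -
  obtain d where d: "k = Suc d" "0 < d" using \<open>2 \<le> k\<close> by (cases k) auto
  \<comment> \<open>Chosen so that the final error \<open>2 ^ H * (2 * M * \<epsilon>)\<close>
    equals 1/4.\<close>
  define \<epsilon> where "\<epsilon> = 1 / (8 * 2 ^ H * real_of_int M)"
  have M0: "0 < real_of_int M" using \<open>2 \<le> M\<close> by simp
  have \<epsilon>0: "0 < \<epsilon>" using M0 by (simp add: \<epsilon>_def)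
  obtain \<theta> \<eta> N where par: "0 < \<theta>" "\<theta> < \<epsilon>" "0 < \<eta>" "\<eta> < \<epsilon>" and
    near: "\<And>u :: nat \<Rightarrow> real. \<forall>t\<le>N. \<exists>m::int. \<bar>fdiff d u t - m - \<theta>\<bar> \<le> \<eta> \<Longrightarrow>
      \<exists>t\<le>N. \<forall>j<d. \<exists>m::int. \<bar>fdiff j u t - m\<bar> < \<epsilon>"
    using fdiff_simultaneously_near_int[OF \<epsilon>0, of d] by metis
  \<comment> \<open>Steps of at most \<delta> add up to at most \<open>M * \<eta>\<close> over
    \<open>N + 1\<close> steps.\<close>
  define \<delta> where "\<delta> = real_of_int M * \<eta> / (real N + 1)"
  have \<delta>0: "0 < \<delta>" using par M0 by (simp add: \<delta>_def)
  have \<delta>_le: "\<delta> * (real N + 1) = M * \<eta>" by (simp add: \<delta>_def)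
  have "\<delta> * 1 \<le> \<delta> * (real N + 1)" using \<delta>0 by (intro mult_left_mono) auto
  then have \<delta>_le': "\<delta> \<le> M * \<epsilon>" using \<delta>_le par M0
    by (smt (verit) mult_left_mono)
  obtain n1 where n1: "\<And>n. n1 \<le> n \<Longrightarrow> \<bar>fdiff k u n\<bar> \<le> \<delta>"
    using LIMSEQ_D[OF lim \<delta>0] by (auto intro: less_imp_le)
  define n2 where "n2 = max n0 n1"
  \<comment> \<open>This \<open>m\<close> puts the level \<open>b\<close> above the value at
    \<open>n2\<close>, so that \<open>b\<close> is reached later and from below.\<close>
  obtain m where m: "fdiff d u n2 / M < 2 ^ m" using real_arch_pow[of 2 "fdiff d u n2 / M"] by auto
  \<comment> \<open>Divided by \<open>M\<close>, the level is an integer plus \<theta>, as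
    \<open>near\<close> demands.\<close>
  define b where "b = M * (\<theta> + M ^ m)"
  have "(2::real) ^ m \<le> M ^ m" unfolding of_int_power using \<open>2 \<le> M\<close> by (intro power_mono) auto
  then have "fdiff d u n2 / M < \<theta> + M ^ m" using m par by linarith
  then have b: "fdiff d u n2 < b" using M0 by (simp add: b_def pos_divide_less_eq mult.commute)
  \<comment> \<open>At the first \<open>n\<close> reaching \<open>b\<close> the preceding value is
    still below \<open>b\<close>, so the value at \<open>n\<close> is within \<delta> of it.\<close>
  have "\<exists>n\<ge>n2. b \<le> fdiff d u n" using unb[of n2 b] d by simp
  then obtain n where n: "n2 \<le> n" "b \<le> fdiff d u n" and least: "\<And>n'. n' < n \<Longrightarrow> \<not> (n2 \<le> n' \<and> b \<le> fdiff d u n')"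
    using exists_least_iff[of "\<lambda>n. n2 \<le> n \<and> b \<le> fdiff d u n"] by blast
  have "n \<noteq> n2" using n b by auto
  then obtain n' where n': "n = Suc n'" "n2 \<le> n'" using n by (cases n) auto
  have step: "\<bar>fdiff d u (Suc t) - fdiff d u t\<bar> \<le> \<delta>" if "n2 \<le> t" for t
    using n1[of t] that d by (simp add: n2_def)
  have "fdiff d u n' < b" using least[of n'] n' by auto
  then have start: "\<bar>fdiff d u n - b\<bar> \<le> \<delta>" using step[OF n'(2)] n n' by (simp add: abs_le_iff)
  have window: "\<bar>fdiff d u (n + t) - b\<bar> \<le> \<delta> * (real t + 1)" for t
  proof (induction t)
    case (Suc t)
    then show ?case using step[of "n + t"] n(1) by (simp add: algebra_simps abs_le_iff)
  qed (use start in simp)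
  have window': "\<bar>fdiff d u (n + t) - b\<bar> \<le> M * \<eta>" if "t \<le> N" for t
  proof -
    have "\<delta> * (real t + 1) \<le> \<delta> * (real N + 1)" using that \<delta>0 by (intro mult_left_mono) auto
    then show ?thesis using window[of t] \<delta>_le by linarith
  qed
  \<comment> \<open>Closeness of \<open>v\<close> to an integer means closeness of \<open>u\<close>
    to 3/2 modulo \<open>M\<close>; differences of positive order do not see the shift.\<close>
  define v where "v t = (u (n + t) - 3 / 2) / M" for t
  have v: "fdiff j v t = (fdiff j u (n + t) - (if j = 0 then 3 / 2 else 0)) / M" for j t
    unfolding v_def fdiff_divide fdiff_diff fdiff_shift fdiff_const by simp
  have "\<exists>i::int. \<bar>fdiff d v t - i - \<theta>\<bar> \<le> \<eta>" if "t \<le> N" for t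
  proof (rule exI[of _ "M ^ m"])
    have "fdiff d v t - of_int (M ^ m) - \<theta> = (fdiff d u (n + t) - b) / M"
      using d M0 by (simp add: v b_def field_simps)
    then show "\<bar>fdiff d v t - of_int (M ^ m) - \<theta>\<bar> \<le> \<eta>"
      using window'[OF that] M0 by (simp add: abs_divide pos_divide_le_eq mult.commute)
  qed
  then obtain t where t: "t \<le> N" and tj: "\<And>j. j < d \<Longrightarrow> \<exists>m::int. \<bar>fdiff j v t - m\<bar> < \<epsilon>"
    using near[of v] by blast
  obtain a :: "nat \<Rightarrow> int" where a: "\<And>j. j < d \<Longrightarrow> \<bar>fdiff j v t - a j\<bar> < \<epsilon>"
    using tj by metis
  \<comment> \<open>The top coefficient is \<open>b\<close> without its part
    \<open>M * \<theta>\<close>. Of the 3/2 in \<open>v\<close>, the 1 goes into \<open>A 0\<close>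
    and the 1/2 into \<open>e\<close>, which centres \<open>u\<close> between consecutive
    integers.\<close>
  define A where "A j = (if j = d then M ^ Suc m else M * a j + (if j = 0 then 1 else 0))" for j
  define P where "P h = (\<Sum>j<k. A j * int (h choose j))" for h
  define e where "e h = u (n + t + h) - (1 / 2 + real_of_int (P h))" for h
  have fP: "fdiff j (\<lambda>h. real_of_int (P h)) h = (\<Sum>i<k - j. A (i + j) * (h choose i))" if "j \<le> k" for j h
    using fdiff_binomial_sum[OF that, of "\<lambda>j. real_of_int (A j)" h] by (simp add: P_def)
  have fP0: "fdiff j (\<lambda>h. real_of_int (P h)) 0 = A j" if j: "j < k" for j
  proof -
    obtain l where "k - j = Suc l" using j by (metis Suc_diff_Suc)
    then show ?thesis using fP[of j 0] j by (simp add: sum.lessThan_Suc_shift del: sum.lessThan_Suc)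
  qed
  have fe: "fdiff j e h = fdiff j u (n + t + h) - (if j = 0 then 1 / 2 else 0) - fdiff j (\<lambda>h. real_of_int (P h)) h" for j h
    unfolding e_def using fdiff_diff[of j "\<lambda>h. u (n + t + h) - 1 / 2" "\<lambda>h. real_of_int (P h)" h]
      fdiff_diff[of j "\<lambda>h. u (n + t + h)" "\<lambda>h. 1 / 2" h]
    by (simp add: fdiff_shift fdiff_const diff_diff_eq)
  have e0: "\<bar>fdiff j e 0\<bar> \<le> 2 * M * \<epsilon>" if "j < k" for j
  proof (cases "j = d")
    case True
    \<comment> \<open>The factor 2 in the bound arises here: the drift within the window and the
      omitted \<open>M * \<theta>\<close> each cost at most \<open>M * \<epsilon>\<close>.\<close>
    have "fdiff j e 0 = fdiff d u (n + t) - b + M * \<theta>"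
      using True d by (simp add: fe fP0 A_def b_def algebra_simps)
    moreover have "\<bar>fdiff d u (n + t) - b\<bar> \<le> M * \<eta>" by (rule window'[OF t])
    moreover have "M * \<eta> \<le> M * \<epsilon>" "M * \<theta> \<le> M * \<epsilon>" "0 \<le> M * \<theta>" using par M0 by auto
    ultimately show ?thesis by (simp only: abs_le_iff mult.assoc) linarith
  next
    case False
    then have "j < d" using that d by simp
    have vM: "M * fdiff j v t = fdiff j u (n + t) - (if j = 0 then 3 / 2 else 0)"
      using M0 by (simp add: v)
    have "fdiff j e 0 = M * (fdiff j v t - a j)"
      using False that vM by (simp add: fe fP0 A_def right_diff_distrib)
    then have "\<bar>fdiff j e 0\<bar> = M * \<bar>fdiff j v t - a j\<bar>" using M0 by (simp add: abs_mult)
    also have "\<dots> \<le> M * \<epsilon>" using a[OF \<open>j < d\<close>] M0 by (intro mult_left_mono) auto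
    also have "\<dots> \<le> 2 * M * \<epsilon>" using M0 \<epsilon>0 by simp
    finally show ?thesis .
  qed
  have ek: "\<bar>fdiff k e h\<bar> \<le> 2 * M * \<epsilon>" for h
  proof -
    have "fdiff k e h = fdiff k u (n + t + h)"
      using d(1) fP[of k h] by (simp only: fe) simp
    then have "\<bar>fdiff k e h\<bar> \<le> \<delta>" using n1[of "n + t + h"] n by (simp add: n2_def)
    moreover have "M * \<epsilon> \<le> 2 * M * \<epsilon>" using M0 \<epsilon>0 by simp
    ultimately show ?thesis using \<delta>_le' by linarith
  qed
  have "\<lfloor>u (n + t + h)\<rfloor> = P h" if "h \<le> H" for h
  proof -
    have "\<bar>fdiff 0 e h\<bar> \<le> 2 ^ h * (2 * M * \<epsilon>)"
      by (rule abs_le_of_fdiff_small[of k e _ H]) (use e0 ek M0 \<epsilon>0 that in auto)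
    also have "\<dots> \<le> 2 ^ H * (2 * M * \<epsilon>)"
      using that M0 \<epsilon>0 by (intro mult_right_mono power_increasing) auto
    also have "\<dots> = 1 / 4" using M0 by (simp add: \<epsilon>_def)
    finally have "\<bar>e h\<bar> \<le> 1 / 4" by simp
    then show ?thesis unfolding e_def by (intro floor_unique) (simp_all only: abs_le_iff, linarith+)
  qed
  moreover have "M dvd A 0 - 1" using d by (simp add: A_def)
  moreover have "\<forall>j. 0 < j \<and> j < k \<longrightarrow> M dvd A j" by (simp add: A_def)
  moreover have "A (k - 1) = M ^ Suc m" using d by (simp add: A_def)
  moreover have "n0 \<le> n + t" using n(1) by (simp add: n2_def)
  ultimately show ?thesis unfolding P_def by blast
qed

section \<open>Integer polynomials modulo a prime, and the gcd\<close>

text \<open>Lagrange's bound on roots modulo \<open>p\<close>. Division by X - x for a root x leaves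
  a quotient that vanishes modulo \<open>p\<close> at the other roots and inherits the coefficient.
  Only a degree bound is asked, so that coefficient may be 0.\<close>

lemma prime_dvd_coeff_of_many_roots:
  fixes Q :: "int poly"
  assumes "prime p" "degree Q \<le> d" "finite S" "card S = Suc d"
    and "\<And>x. x \<in> S \<Longrightarrow> p dvd poly Q x"
    and "\<And>x y. x \<in> S \<Longrightarrow> y \<in> S \<Longrightarrow> x \<noteq> y \<Longrightarrow> \<not> p dvd x - y"
  shows "p dvd coeff Q d"
  using assms(2-)
proof (induction d arbitrary: Q S)
  case 0
  then obtain x where "x \<in> S" by (metis card.empty equals0I nat.distinct(1))
  moreover have "poly Q x = coeff Q 0" using 0 by (auto elim: degree_eq_zeroE)
  ultimately show ?case using 0 by metis
next
  case (Suc d)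
  obtain x where x: "x \<in> S" using Suc.prems(3) by (metis card.empty equals0I nat.distinct(1))
  define R where "R = synthetic_div Q x"
  have R: "Q + smult x R = pCons (poly Q x) R" unfolding R_def by (rule synthetic_div_correct)
  have dR: "degree R \<le> d" using Suc.prems(1) by (simp add: R_def degree_synthetic_div)
  have "p dvd poly R y" if "y \<in> S - {x}" for y
  proof -
    have "poly Q y + x * poly R y = poly Q x + y * poly R y"
      using arg_cong[OF R, of "\<lambda>q. poly q y"] by simp
    then have "(x - y) * poly R y = poly Q x - poly Q y" by (simp add: algebra_simps)
    then have "p dvd (x - y) * poly R y" using Suc.prems(4) x that by auto
    moreover have "\<not> p dvd x - y" using Suc.prems(5)[of x y] x that by auto
    ultimately show ?thesis using \<open>prime p\<close> by (simp add: prime_dvd_mult_iff)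
  qed
  then have "p dvd coeff R d"
    using Suc.prems(2-) x dR by (intro Suc.IH[of R "S - {x}"]) auto
  moreover have "coeff Q (Suc d) = coeff R d"
    using arg_cong[OF R, of "\<lambda>q. coeff q (Suc d)"] dR by (simp add: coeff_eq_0)
  ultimately show ?case by simp
qed

text \<open>The factor \<open>fact d\<close> clears all denominators, and only the term
  \<open>j = d\<close> has degree \<open>d\<close>; times \<open>fact d\<close> that binomial
  becomes monic.\<close>

lemma ex_poly_eq_fact_binomial_sum:
  fixes A :: "nat \<Rightarrow> int"
  shows "\<exists>Q :: int poly. degree Q \<le> d \<and> coeff Q d = A d \<and>
    (\<forall>h::nat. poly Q (int h) = fact d * (\<Sum>j<Suc d. A j * int (h choose j)))"
proof (induction d)
  case 0
  show ?case by (intro exI[of _ "[:A 0:]"]) auto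
next
  case (Suc d)
  then obtain Q where Q: "degree Q \<le> d" "coeff Q d = A d"
    "\<And>h::nat. poly Q (int h) = fact d * (\<Sum>j<Suc d. A j * int (h choose j))" by blast
  \<comment> \<open>The falling factorial X (X - 1) ... (X - j + 1).\<close>
  define B :: "nat \<Rightarrow> int poly" where "B j = (\<Prod>i<j. [:- int i, 1:])" for j
  have degB: "degree (B j) \<le> j \<and> coeff (B j) j = 1" for j
  proof (induction j)
    case (Suc j)
    have "B (Suc j) = [:- int j, 1:] * B j" by (simp add: B_def mult.commute)
    also have "\<dots> = pCons 0 (B j) - smult (int j) (B j)" by simp
    finally have *: "B (Suc j) = pCons 0 (B j) - smult (int j) (B j)" .
    have "degree (B (Suc j)) \<le> Suc j"
      unfolding * using Suc by (intro degree_diff_le) (auto simp: degree_pCons_eq_if intro: le_trans[OF degree_smult_le])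
    moreover have "coeff (B (Suc j)) (Suc j) = 1" unfolding * using Suc by (simp add: coeff_eq_0)
    ultimately show ?case by simp
  qed (simp add: B_def)
  have B: "poly (B j) (int h) = fact j * int (h choose j)" for j h
  proof -
    have "poly (B j) (int h) = (\<Prod>i<j. int h - int i)" by (simp add: B_def poly_prod)
    also have "\<dots> = fact j * int (h choose j)"
    proof (cases "j \<le> h")
      case True
      have "(\<Prod>i<j. int h - int i) = int (\<Prod>i<j. h - i)"
        using True by (simp add: of_nat_diff)
      also have "(\<Prod>i<j. h - i) = fact j * (h choose j)"
      proof -
        have "(\<Prod>i<j. h - i) * fact (h - j) = fact h"
          using True
        proof (induction j)
          case (Suc j)
          have "fact (h - j) = (h - j) * fact (h - Suc j)"
            using Suc.prems by (simp add: fact_reduce)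
          then show ?case using Suc by (simp add: mult.assoc)
        qed simp
        moreover have "fact j * (h choose j) * fact (h - j) = fact h"
          using binomial_fact_lemma[OF True] by (simp add: mult_ac)
        ultimately show ?thesis by (metis fact_nonzero mult_right_cancel)
      qed
      finally show ?thesis by simp
    next
      case False
      then have "(\<Prod>i<j. int h - int i) = 0" by (intro prod_zero) (auto intro!: bexI[of _ h])
      then show ?thesis using False by (simp add: binomial_eq_0)
    qed
    finally show ?thesis .
  qed
  define R where "R = smult (int (Suc d)) Q + smult (A (Suc d)) (B (Suc d))"
  have "degree R \<le> Suc d" unfolding R_def
    using Q(1) degB[of "Suc d"]
    by (intro degree_add_le) (auto intro: le_trans[OF degree_smult_le])
  moreover have "coeff R (Suc d) = A (Suc d)"
    using Q(1) degB[of "Suc d"] by (simp add: R_def coeff_eq_0)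
  moreover have "poly R (int h) = fact (Suc d) * (\<Sum>j<Suc (Suc d). A j * int (h choose j))" for h
    by (simp add: R_def Q(3) B sum.lessThan_Suc[of _ "Suc d"] algebra_simps del: sum.lessThan_Suc of_nat_Suc)
  ultimately show ?case by blast
qed

lemma Gcd_binomial_sum_eq_1:
  fixes A :: "nat \<Rightarrow> int" and S :: "nat set"
  assumes "2 \<le> k" "S \<subseteq> {1..H}" "card S = k"
    and A: "fact H dvd A 0 - 1" "\<And>j. 0 < j \<Longrightarrow> j < k \<Longrightarrow> fact H dvd A j" "A (k - 1) = fact H ^ m"
  shows "(GCD h\<in>S. \<Sum>j<k. A j * int (h choose j)) = 1"
proof (rule ccontr)
  define P where "P h = (\<Sum>j<k. A j * int (h choose j))" for h
  have fin: "finite S" using assms(2) finite_subset by blast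
  obtain d where d: "k = Suc d" using \<open>2 \<le> k\<close> by (cases k) auto
  assume "(GCD h\<in>S. \<Sum>j<k. A j * int (h choose j)) \<noteq> 1"
  then have "Gcd (P ` S) \<noteq> 1" by (simp add: P_def)
  then have "\<not> is_unit (Gcd (P ` S))" by (metis is_unit_normalize normalize_Gcd)
  \<comment> \<open>A gcd of 0 is included: every prime divides it, for instance 2.\<close>
  then obtain p :: int where p: "prime p" "p dvd Gcd (P ` S)"
    by (metis dvd_0_right prime_divisorE two_is_prime)
  then have pP: "p dvd P h" if "h \<in> S" for h using that by (meson Gcd_dvd dvd_trans imageI)
  obtain h0 where h0: "h0 \<in> S" using assms(1,3) by fastforce
  \<comment> \<open>Otherwise all terms of \<open>P h0\<close> but \<open>A 0\<close> vanish modulo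
    \<open>p\<close>, while \<open>A 0\<close> is 1 modulo \<open>p\<close>.\<close>
  have notdvd: "\<not> p dvd fact H"
  proof
    assume pH: "p dvd fact H"
    have "P h0 = A 0 + (\<Sum>j<d. A (Suc j) * int (h0 choose Suc j))"
      unfolding P_def d sum.lessThan_Suc_shift by simp
    moreover have "p dvd (\<Sum>j<d. A (Suc j) * int (h0 choose Suc j))"
      using A(2) pH d by (intro dvd_sum dvd_mult2) (auto intro: dvd_trans)
    ultimately have "p dvd A 0" using pP[OF h0] by (simp add: dvd_add_left_iff)
    moreover have "p dvd A 0 - 1" using pH A(1) by (rule dvd_trans)
    ultimately have "p dvd 1" using dvd_diff[of p "A 0" "A 0 - 1"] by simp
    then show False using p(1) not_prime_unit by blast
  qed
  obtain Q :: "int poly" where Q: "degree Q \<le> d" "coeff Q d = A d"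
    "\<And>h::nat. poly Q (int h) = fact d * P h"
    using ex_poly_eq_fact_binomial_sum[of d A] unfolding P_def d by blast
  have "p dvd coeff Q d"
  proof (rule prime_dvd_coeff_of_many_roots[OF p(1) Q(1), of "int ` S"])
    show "card (int ` S) = Suc d" using assms(3) d by (simp add: card_image)
    show "p dvd poly Q x" if "x \<in> int ` S" for x using that pP Q(3) by auto
    show "\<not> p dvd x - y" if "x \<in> int ` S" "y \<in> int ` S" "x \<noteq> y" for x y
    proof
      assume xy: "p dvd x - y"
      \<comment> \<open>A nonzero difference of two elements of {1..H} is a factor of
        \<open>fact H\<close>, so the roots are distinct modulo \<open>p\<close>.\<close>
      define r where "r = nat \<bar>x - y\<bar>"
      have "x \<in> {1..int H}" "y \<in> {1..int H}" using that assms(2) by auto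
      then have "1 \<le> r" "r \<le> H" using \<open>x \<noteq> y\<close> by (auto simp: r_def)
      then have "int r dvd int (fact H)" using dvd_fact[of r H] by (simp only: of_nat_dvd_iff)
      moreover have "p dvd int r" using xy by (simp add: r_def)
      ultimately show False using notdvd by (metis dvd_trans of_nat_fact)
    qed
  qed (use fin in auto)
  then have "p dvd fact H ^ m" using Q(2) A(3) d by simp
  then show False using notdvd p(1) prime_dvd_power by blast
qed

section \<open>From derivatives to differences, and the conclusion\<close>

text \<open>An iterated mean value theorem. Stating it for a family \<open>G\<close> lets the
  induction pass to the functions \<open>G i (x + 1) - G i x\<close>, again a chain of derivatives;
  one more mean value step turns the last difference into a derivative.\<close>

lemma fdiff_eq_derivative:
  fixes G :: "nat \<Rightarrow> real \<Rightarrow> real"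
  assumes "\<And>i x. i < j \<Longrightarrow> a \<le> x \<Longrightarrow> (G i has_real_derivative G (Suc i) x) (at x within {a..})"
    and "a \<le> real n"
  shows "\<exists>\<xi>\<in>{real n..real (n + j)}. fdiff j (\<lambda>t. G 0 (real t)) n = G j \<xi>"
  using assms(1)
proof (induction j arbitrary: G)
  case 0
  show ?case by auto
next
  case (Suc j)
  have deriv: "((\<lambda>x. G i (x + 1) - G i x) has_real_derivative G (Suc i) (x + 1) - G (Suc i) x) (at x within {a..})"
    if "i < j" "a \<le> x" for i x
  proof -
    have "(G i has_real_derivative G (Suc i) (x + 1)) (at (x + 1) within (\<lambda>x. x + 1) ` {a..})"
      by (rule DERIV_subset[OF Suc.prems[of i "x + 1"]]) (use that in auto)
    then have "(G i \<circ> (\<lambda>x. x + 1) has_real_derivative G (Suc i) (x + 1) * 1) (at x within {a..})"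
      by (rule DERIV_image_chain) (auto intro!: derivative_eq_intros)
    then show ?thesis using Suc.prems[of i x] that
      by (auto intro!: DERIV_diff simp: o_def)
  qed
  obtain \<xi> where \<xi>: "\<xi> \<in> {real n..real (n + j)}"
    "fdiff j (\<lambda>t. G 0 (real t + 1) - G 0 (real t)) n = G j (\<xi> + 1) - G j \<xi>"
    using Suc.IH[of "\<lambda>i x. G i (x + 1) - G i x", OF deriv] by auto
  have "\<exists>x\<in>{\<xi>..\<xi> + 1}. G j (\<xi> + 1) - G j \<xi> = G (Suc j) x * (\<xi> + 1 - \<xi>)"
  proof (rule mvt_very_simple)
    fix x assume "\<xi> \<le> x" "x \<le> \<xi> + 1"
    then have "(G j has_real_derivative G (Suc j) x) (at x within {\<xi>..\<xi> + 1})"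
      using \<xi>(1) assms(2) by (intro DERIV_subset[OF Suc.prems[of j x]]) auto
    then show "(G j has_derivative (*) (G (Suc j) x)) (at x within {\<xi>..\<xi> + 1})"
      by (simp add: has_field_derivative_def)
  qed simp
  then obtain x where x: "x \<in> {\<xi>..\<xi> + 1}" "G j (\<xi> + 1) - G j \<xi> = G (Suc j) x" by auto
  have "fdiff (Suc j) (\<lambda>t. G 0 (real t)) n = G (Suc j) x"
    unfolding fdiff_Suc_inner using \<xi>(2) x(2) by (simp add: add.commute)
  then show ?case using x(1) \<xi>(1) by (intro bexI[of _ x]) auto
qed

lemma nth_deriv_within_0 [simp]: "nth_deriv_within S 0 f = f"
  by (simp add: nth_deriv_within_def)

lemma has_real_derivative_nth_deriv_within:
  assumes "times_cont_differentiable_on k f {a..}" "i < k" "a \<le> x"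
  shows "(nth_deriv_within {a..} i f has_real_derivative nth_deriv_within {a..} (Suc i) f x) (at x within {a..})"
proof -
  have "nth_deriv_within {a..} i f differentiable (at x within {a..})"
    using assms by (auto simp: times_cont_differentiable_on_def differentiable_on_def)
  then have "(nth_deriv_within {a..} i f has_vector_derivative
      vector_derivative (nth_deriv_within {a..} i f) (at x within {a..})) (at x within {a..})"
    by (simp add: vector_derivative_works)
  then show ?thesis
    by (simp add: has_real_derivative_iff_has_vector_derivative nth_deriv_within_def)
qed

lemma fdiff_tendsto_0:
  assumes "times_cont_differentiable_on k f {1..}"
    and lim: "(nth_deriv_within {1..} k f \<longlongrightarrow> 0) at_top"
  shows "fdiff k (\<lambda>t. f (real t)) \<longlonglongrightarrow> 0"
proof (rule LIMSEQ_I)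
  fix r :: real assume "0 < r"
  then obtain X where X: "\<And>x. X \<le> x \<Longrightarrow> \<bar>nth_deriv_within {1..} k f x\<bar> < r"
    using lim by (auto simp: tendsto_iff eventually_at_top_linorder)
  have "norm (fdiff k (\<lambda>t. f (real t)) n - 0) < r" if "nat \<lceil>max X 1\<rceil> \<le> n" for n
  proof -
    have n: "X \<le> real n" "1 \<le> real n" using that by linarith+
    obtain \<xi> where "\<xi> \<in> {real n..real (n + k)}"
      "fdiff k (\<lambda>t. f (real t)) n = nth_deriv_within {1..} k f \<xi>"
      using fdiff_eq_derivative[of k 1 "\<lambda>i. nth_deriv_within {1..} i f" n]
        has_real_derivative_nth_deriv_within[OF assms(1)] n by auto
    then show ?thesis using X[of \<xi>] n by simp
  qed
  then show "\<exists>no. \<forall>n\<ge>no. norm (fdiff k (\<lambda>t. f (real t)) n - 0) < r" by blast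
qed

text \<open>The limsup gives real points x where the derivative of order \<open>d\<close> is large,
  whereas the difference at \<open>\<lfloor>x\<rfloor>\<close> is its value at some \<xi>. Since |x
  - \<xi>| is at most \<open>d + 1\<close> and the next derivative is below 1 in absolute value, the
  loss is at most \<open>d + 1\<close>.\<close>

lemma fdiff_unbounded:
  assumes "times_cont_differentiable_on (Suc d) f {1..}"
    and lim: "(nth_deriv_within {1..} (Suc d) f \<longlongrightarrow> 0) at_top"
    and sup: "Limsup at_top (\<lambda>x. ereal (nth_deriv_within {1..} d f x)) = \<infinity>"
  shows "\<exists>n\<ge>n0. B \<le> fdiff d (\<lambda>t. f (real t)) n"
proof -
  let ?D = "\<lambda>i. nth_deriv_within {1..} i f"
  obtain X where X: "\<And>x. X \<le> x \<Longrightarrow> \<bar>?D (Suc d) x\<bar> < 1"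
    using lim unfolding tendsto_iff eventually_at_top_linorder
    by (metis dist_real_def diff_zero zero_less_one)
  \<comment> \<open>The final 1 keeps \<open>\<lfloor>x\<rfloor>\<close>, not only x, beyond all
    three thresholds.\<close>
  define Y where "Y = max X (max 1 (real n0)) + 1"
  have "\<exists>x\<ge>Y. B + real d + 1 < ?D d x"
  proof (rule ccontr)
    assume "\<not> ?thesis"
    then have "\<forall>\<^sub>F x in at_top. ereal (?D d x) \<le> ereal (B + real d + 1)"
      unfolding eventually_at_top_linorder by (intro exI[of _ Y]) (auto simp: not_less)
    then have "Limsup at_top (\<lambda>x. ereal (?D d x)) \<le> ereal (B + real d + 1)"
      by (rule Limsup_bounded)
    then show False using sup by simp
  qed
  then obtain x where x: "Y \<le> x" "B + real d + 1 < ?D d x" by blast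
  define n where "n = nat \<lfloor>x\<rfloor>"
  have n: "real n \<le> x" "x < real n + 1" using x(1) unfolding n_def Y_def by linarith+
  have n': "X \<le> real n" "1 \<le> real n" "n0 \<le> n" using n x(1) unfolding Y_def by linarith+
  obtain \<xi> where \<xi>: "\<xi> \<in> {real n..real (n + d)}" "fdiff d (\<lambda>t. f (real t)) n = ?D d \<xi>"
    using fdiff_eq_derivative[of d 1 ?D n]
      has_real_derivative_nth_deriv_within[OF assms(1)] n' by auto
  have "\<bar>?D d x - ?D d \<xi>\<bar> \<le> 1 * \<bar>x - \<xi>\<bar>"
  proof -
    have "norm (?D d x - ?D d \<xi>) \<le> 1 * norm (x - \<xi>)"
    proof (rule field_differentiable_bound[of "{real n..}" _ "?D (Suc d)"])
      fix z assume "z \<in> {real n..}"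
      then show "(?D d has_field_derivative ?D (Suc d) z) (at z within {real n..})"
        using n' by (intro DERIV_subset[OF has_real_derivative_nth_deriv_within[OF assms(1)]]) auto
      show "norm (?D (Suc d) z) \<le> 1" using X[of z] \<open>z \<in> _\<close> n' by simp
    qed (use n \<xi> in auto)
    then show ?thesis by simp
  qed
  moreover have "\<bar>x - \<xi>\<bar> \<le> real d + 1" using \<xi>(1) n by (auto simp: abs_le_iff)
  ultimately have "B \<le> fdiff d (\<lambda>t. f (real t)) n" using x(2) \<xi>(2) by (simp add: abs_le_iff) linarith
  then show ?thesis using n'(3) by blast
qed

theorem theorem3:
  fixes k H :: nat and f :: "real \<Rightarrow> real"
  assumes "k \<ge> 2"
    and "times_cont_differentiable_on k f {1..}"
    and "(nth_deriv_within {1..} k f \<longlongrightarrow> 0) at_top"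
    and "Limsup at_top (\<lambda>x. ereal (nth_deriv_within {1..} (k - 1) f x)) = \<infinity>"
    and "H \<ge> k"
  shows "infinite {n::nat. n > 0 \<and>
           (\<forall>h :: nat \<Rightarrow> nat. strict_mono_on {1..k} h \<and> h ` {1..k} \<subseteq> {1..H} \<longrightarrow>
              (GCD i\<in>{1..k}. \<lfloor>f (real (n + h i))\<rfloor>) = 1)}"
  unfolding infinite_nat_iff_unbounded
proof (intro allI)
  fix n0 :: nat
  have kS: "k = Suc (k - 1)" using assms(1) by simp
  have "fact 2 \<le> (fact H :: int)" using assms(1,5) by (intro fact_mono) auto
  then have H2: "2 \<le> (fact H :: int)" by simp
  have unb: "\<exists>n\<ge>n1. B \<le> fdiff (k - 1) (\<lambda>t. f (real t)) n" for B n1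
    using fdiff_unbounded[of "k - 1" f n1 B] assms(2,3,4) kS by simp
  obtain n A m where n: "Suc n0 \<le> n" and
    fl: "\<And>h. h \<le> H \<Longrightarrow> \<lfloor>f (real (n + h))\<rfloor> = (\<Sum>j<k. A j * int (h choose j))" and
    A: "fact H dvd A 0 - 1" "\<And>j. 0 < j \<Longrightarrow> j < k \<Longrightarrow> fact H dvd A j" "A (k - 1) = fact H ^ m"
    using floor_eq_binomial_sum_infinitely_often[OF assms(1) H2 fdiff_tendsto_0[OF assms(2,3)] unb,
        of "Suc n0" H] by blast
  have "(GCD i\<in>{1..k}. \<lfloor>f (real (n + h i))\<rfloor>) = 1"
    if h: "strict_mono_on {1..k} h" "h ` {1..k} \<subseteq> {1..H}" for h :: "nat \<Rightarrow> nat"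
  proof -
    have "card (h ` {1..k}) = k"
      using strict_mono_on_imp_inj_on[OF h(1)] by (simp add: card_image)
    from Gcd_binomial_sum_eq_1[OF assms(1) h(2) this A]
    have "Gcd ((\<lambda>i. \<Sum>j<k. A j * int (h i choose j)) ` {1..k}) = 1" by (simp add: image_image)
    moreover have "(\<lambda>i. \<lfloor>f (real (n + h i))\<rfloor>) ` {1..k} = (\<lambda>i. \<Sum>j<k. A j * int (h i choose j)) ` {1..k}"
      using h(2) by (intro image_cong fl) (auto simp: image_subset_iff)
    ultimately show ?thesis by simp
  qed
  then show "\<exists>n>n0. n \<in> {n. n > 0 \<and>
           (\<forall>h :: nat \<Rightarrow> nat. strict_mono_on {1..k} h \<and> h ` {1..k} \<subseteq> {1..H} \<longrightarrow>
              (GCD i\<in>{1..k}. \<lfloor>f (real (n + h i))\<rfloor>) = 1)}"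
    using n by (intro exI[of _ n]) auto
qed

end
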